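(* Let $G$ be a finite simple graph and $e$ an edge of $G$. Let $G'$ be the graph associated to the polarization $\widetilde{(I(G)^2 : e)}$ of the ideal $(I(G)^2 : e)$. Then $$\operatorname{co-chord}(G') \leq \operatorname{co-chord}(G).$$
   Context: Graphs are finite, simple and undirected. For a graph $G$ with vertex set $\{x_1,\ldots,x_n\}$ and a field $k$, the edge ideal is $I(G) = (x_ix_j \mid \{x_i,x_j\}\in E(G)) \subseteq k[x_1,\ldots,x_n]$. An edge $e=\{x_i,x_j\}$ is identified with the monomial $x_ix_j$. The polarization of a monomial $x_1^{m_1}\cdots x_n^{m_n}$ is the squarefree monomial $x_{11}\cdots x_{1m_1}x_{21}\cdots x_{2m_2}\cdots x_{n1}\cdots x_{nm_n}$ in a larger polynomial ring, and the polarization $\widetilde{I}$ of a monomial ideal $I$ is generated by the polarizations of its minimal monomial generators ($x_{i1}$ being identified with $x_i$). By a theorem of Banerjee, $(I(G)^2:e)$ is minimally generated by monomials of degree 2 (possibly squares $x_i^2$), so its polarization is a squarefree quadratic monomial ideal and hence is the edge ideal of a graph $G'$, whose vertices are those of $G$ together with one new vertex for each generator $x_i^2$ (polarized as $x_i$ times the new variable); $G$ is a subgraph of $G'$. A graph is chordal if every induced cycle in it has length $3$; a graph is co-chordal if its complement is chordal. The co-chordal cover number $\operatorname{co-chord}(G)$ is the minimum number $n$ such that there exist co-chordal subgraphs $H_1,\ldots,H_n$ of $G$ (not necessarily induced) with $E(G)=\bigcup_{i=1}^n E(H_i)$. *)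

theory Defs
  imports "HOL-Library.Poly_Mapping" "HOL-Algebra.Ideal_Product"
begin

section \<open>Graphs\<close>

record 'a ugraph =
  verts :: "'a set"
  edges :: "'a set set"

definition simple_graph :: "'a ugraph \<Rightarrow> bool" where
  "simple_graph G \<longleftrightarrow> (\<forall>d \<in> edges G. d \<subseteq> verts G \<and> card d = 2)"

definition finite_simple_graph :: "'a ugraph \<Rightarrow> bool" where
  "finite_simple_graph G \<longleftrightarrow> simple_graph G \<and> finite (verts G)"

definition subgraph_of :: "'a ugraph \<Rightarrow> 'a ugraph \<Rightarrow> bool" where
  "subgraph_of H G \<longleftrightarrow> simple_graph H \<and> verts H \<subseteq> verts G \<and> edges H \<subseteq> edges G"

definition complement_graph :: "'a ugraph \<Rightarrow> 'a ugraph" where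
  "complement_graph G =
     \<lparr>verts = verts G, edges = {d. d \<subseteq> verts G \<and> card d = 2 \<and> d \<notin> edges G}\<rparr>"

text \<open>The list \<open>c\<close> enumerates, in cyclic order, vertices inducing a cycle: two of them are
  adjacent exactly if they are cyclically consecutive.\<close>

definition induced_cycle :: "'a ugraph \<Rightarrow> 'a list \<Rightarrow> bool" where
  "induced_cycle G c \<longleftrightarrow>
     3 \<le> length c \<and> distinct c \<and> set c \<subseteq> verts G \<and>
     (\<forall>i < length c. \<forall>j < length c.
        {c ! i, c ! j} \<in> edges G \<longleftrightarrow> j = Suc i mod length c \<or> i = Suc j mod length c)"

definition chordal :: "'a ugraph \<Rightarrow> bool" where
  "chordal G \<longleftrightarrow> (\<forall>c. induced_cycle G c \<longrightarrow> length c = 3)"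

definition co_chordal :: "'a ugraph \<Rightarrow> bool" where
  "co_chordal G \<longleftrightarrow> chordal (complement_graph G)"

text \<open>For a finite graph the minimum is over a nonempty set, since a single edge with its two
  endpoints is a co-chordal subgraph.\<close>

definition co_chord :: "'a ugraph \<Rightarrow> nat" where
  "co_chord G =
     (LEAST n. \<exists>H :: nat \<Rightarrow> 'a ugraph.
        (\<forall>i < n. subgraph_of (H i) G \<and> co_chordal (H i)) \<and>
        edges G = (\<Union>i < n. edges (H i)))"


section \<open>Polynomial rings and edge ideals\<close>

text \<open>Monomials are represented by their exponent functions.  The type \<open>('x, 'k) mpoly\<close> has one
  variable for each element of \<open>'x\<close>; the ring in the variables \<open>V\<close> is carved out of it.\<close>

type_synonym 'x monomial = "'x \<Rightarrow>\<^sub>0 nat"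
type_synonym ('x, 'k) mpoly = "'x monomial \<Rightarrow>\<^sub>0 'k"

definition mpoly_ring :: "'x set \<Rightarrow> ('x, 'k::field) mpoly ring" where
  "mpoly_ring V =
     \<lparr>carrier = {f. \<forall>m \<in> Poly_Mapping.keys f. Poly_Mapping.keys m \<subseteq> V},
      mult = (*), one = 1, zero = 0, add = (+)\<rparr>"

definition mono_poly :: "'x monomial \<Rightarrow> ('x, 'k::field) mpoly" where
  "mono_poly m = Poly_Mapping.single m 1"

definition edge_monomial :: "'x set \<Rightarrow> 'x monomial" where
  "edge_monomial d = (\<Sum>v\<in>d. Poly_Mapping.single v 1)"

definition edge_ideal :: "'x ugraph \<Rightarrow> ('x, 'k::field) mpoly set" where
  "edge_ideal G =
     genideal (mpoly_ring (verts G)) ((\<lambda>d. mono_poly (edge_monomial d)) ` edges G)"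

definition colon_ideal :: "('r, 'm) ring_scheme \<Rightarrow> 'r set \<Rightarrow> 'r \<Rightarrow> 'r set" where
  "colon_ideal R I f = {g \<in> carrier R. g \<otimes>\<^bsub>R\<^esub> f \<in> I}"


section \<open>Polarization\<close>

definition min_mono_gens :: "('x, 'k::field) mpoly set \<Rightarrow> 'x monomial set" where
  "min_mono_gens J =
     {m. mono_poly m \<in> J \<and>
         (\<forall>m'. mono_poly m' \<in> J \<and> (\<forall>v. Poly_Mapping.lookup m' v \<le> Poly_Mapping.lookup m v)
               \<longrightarrow> m' = m)}"

text \<open>The pair \<open>(v, j)\<close> with \<open>j \<ge> 1\<close> is the \<open>j\<close>-th variable attached to \<open>v\<close>; the variable
  \<open>v\<close> itself is identified with \<open>(v, 1)\<close>.\<close>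

definition polarize_monomial :: "'x monomial \<Rightarrow> ('x \<times> nat) monomial" where
  "polarize_monomial m =
     (\<Sum>v \<in> Poly_Mapping.keys m. \<Sum>j = 1..Poly_Mapping.lookup m v. Poly_Mapping.single (v, j) 1)"

text \<open>The variables of the ring in which the polarization of \<open>J\<close> lives: the old ones and those
  new ones which occur in a polarized generator.  If the minimal generators are quadratic, the
  new ones are the \<open>(v, 2)\<close> for the generators \<open>v\<^sup>2\<close>.\<close>

definition polarization_vars :: "'x set \<Rightarrow> ('x, 'k::field) mpoly set \<Rightarrow> ('x \<times> nat) set" where
  "polarization_vars V J =
     V \<times> {1} \<union> (\<Union>m \<in> min_mono_gens J. Poly_Mapping.keys (polarize_monomial m))"

definition polarization :: "'x set \<Rightarrow> ('x, 'k::field) mpoly set \<Rightarrow> ('x \<times> nat, 'k) mpoly set" where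
  "polarization V J =
     genideal (mpoly_ring (polarization_vars V J))
       ((\<lambda>m. mono_poly (polarize_monomial m)) ` min_mono_gens J)"

text \<open>The graph on \<open>W\<close> whose edge ideal is a given squarefree quadratic monomial ideal in the
  polynomial ring on \<open>W\<close>.\<close>

definition graph_of_ideal :: "'x set \<Rightarrow> ('x, 'k::field) mpoly set \<Rightarrow> 'x ugraph" where
  "graph_of_ideal W J =
     \<lparr>verts = W, edges = {d. d \<subseteq> W \<and> card d = 2 \<and> mono_poly (edge_monomial d) \<in> J}\<rparr>"

end

theory Submission imports Defs begin

text \<open>The quadratic generators of \<open>(I(G)\<^sup>2 : xy)\<close> are the edges of \<open>G\<close> and the products \<open>u v\<close> with
  \<open>u \<in> N(x)\<close> and \<open>v \<in> N(y)\<close>; comparing exponents shows that every monomial of the colon ideal is a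
  multiple of one of them (\<open>mono_poly_in_colon_iff\<close>).  Polarizing, \<open>G'\<close> arises from \<open>G\<close> by joining
  every neighbour of \<open>x\<close> to every neighbour of \<open>y\<close> other than itself, and by attaching a pendant
  vertex to every common neighbour (\<open>edges_polarized_colon_graph\<close>).

  Take a minimum cover of \<open>G\<close> by co-chordal subgraphs.  One of them, \<open>H\<close>, contains the edge \<open>xy\<close>.  Add
  all new edges to this \<open>H\<close> and leave the other members alone.  This is a cover of \<open>G'\<close> with the same
  number of members, and it remains to see that the enlarged \<open>H\<close> is co-chordal
  (\<open>co_chordal_join\<close>).  The point is that \<open>xy\<close> is an edge of \<open>H\<close>: since \<open>H\<close> does not contain two
  disjoint edges without an edge between them, every edge of \<open>H\<close> has an end in \<open>N(x) \<union> N(y)\<close>.  So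
  the remaining vertices are pairwise nonadjacent.  In an induced complement of a cycle of length at
  least four, at most two of them can therefore occur, and only in consecutive positions.  That is
  too few to separate \<open>N(x)\<close> from \<open>N(y)\<close> on the cycle, where consecutive vertices are not adjacent:
  no edge of the join occurs, and the obstruction would already be one in \<open>H\<close>.\<close>

section \<open>Anticycles and co-chordal graphs\<close>

text \<open>Being co-chordal is used only through forbidden subgraphs: there is no induced complement of a
  cycle of length at least four.  Speaking of these anticycles avoids complement graphs.\<close>

definition anticycle :: "'a ugraph \<Rightarrow> 'a list \<Rightarrow> bool" where
  "anticycle G c \<longleftrightarrow>
     4 \<le> length c \<and> distinct c \<and> set c \<subseteq> verts G \<and>
     (\<forall>i < length c. \<forall>j < length c. i \<noteq> j \<longrightarrow>
        ({c ! i, c ! j} \<in> edges G \<longleftrightarrow> \<not> (j = Suc i mod length c \<or> i = Suc j mod length c)))"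

lemma co_chordal_iff: "co_chordal G \<longleftrightarrow> (\<nexists>c. anticycle G c)"
proof -
  have "anticycle G c \<longleftrightarrow> induced_cycle (complement_graph G) c \<and> length c \<noteq> 3" for c
  proof -
    have "{c ! i, c ! j} \<in> edges (complement_graph G) \<longleftrightarrow> i \<noteq> j \<and> {c ! i, c ! j} \<notin> edges G"
      if "distinct c" "set c \<subseteq> verts G" "i < length c" "j < length c" for i j
    proof -
      have "{c ! i, c ! j} \<subseteq> verts G" using that nth_mem by auto
      moreover have "card {c ! i, c ! j} = 2 \<longleftrightarrow> i \<noteq> j"
        using that by (auto simp: card_insert_if nth_eq_iff_index_eq)
      ultimately show ?thesis by (auto simp: complement_graph_def)
    qed
    moreover have "Suc i mod length c \<noteq> i" if "4 \<le> length c" "i < length c" for i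
      using that by (cases "Suc i = length c") auto
    ultimately show ?thesis
      unfolding anticycle_def induced_cycle_def
      by (auto simp: complement_graph_def) metis+
  qed
  then show ?thesis by (auto simp: co_chordal_def chordal_def)
qed

text \<open>Indices are read modulo the length, so that the arguments about arcs of the cycle below can
  start anywhere and run past the end of the list.\<close>

lemma anticycle_mod_edge:
  fixes p d :: nat
  assumes c: "anticycle G c" and d: "2 \<le> d" "d + 2 \<le> length c"
  shows "{c ! (p mod length c), c ! ((p + d) mod length c)} \<in> edges G"
proof -
  let ?n = "length c"
  have n: "4 \<le> ?n" using c by (simp add: anticycle_def)
  define i where "i = p mod ?n"
  have i: "i < ?n" using n unfolding i_def by (intro mod_less_divisor) linarith
  have j: "(p + d) mod ?n = (if i + d < ?n then i + d else i + d - ?n)"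
  proof -
    have "(p + d) mod ?n = (i + d) mod ?n" by (simp add: i_def mod_simps)
    then show ?thesis using i d by (simp add: le_mod_geq)
  qed
  have si: "Suc k mod ?n = (if Suc k = ?n then 0 else Suc k)" if "k < ?n" for k
    using that by auto
  show ?thesis
    using c i d n unfolding anticycle_def j i_def[symmetric]
    by (auto simp: si split: if_splits)
qed

lemma anticycle_mod_nonedge:
  assumes c: "anticycle G c"
  shows "{c ! (p mod length c), c ! (Suc p mod length c)} \<notin> edges G"
    and "c ! (p mod length c) \<noteq> c ! (Suc p mod length c)"
proof -
  let ?n = "length c"
  have n: "4 \<le> ?n" and "distinct c" using c by (simp_all add: anticycle_def)
  have lt: "p mod ?n < ?n" "Suc p mod ?n < ?n" using n by (auto intro!: mod_less_divisor)
  have eq: "Suc p mod ?n = Suc (p mod ?n) mod ?n" by (simp add: mod_Suc_eq)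
  have "p mod ?n \<noteq> Suc p mod ?n" using n by (auto simp: mod_Suc)
  then show "{c ! (p mod ?n), c ! (Suc p mod ?n)} \<notin> edges G"
    and "c ! (p mod ?n) \<noteq> c ! (Suc p mod ?n)"
    using c lt eq by (auto simp: anticycle_def nth_eq_iff_index_eq)
qed

text \<open>Two disjoint edges with no edge between them form the anticycle of length four.\<close>

lemma co_chordal_two_edges:
  assumes H: "co_chordal H" "simple_graph H" and e: "{x, y} \<in> edges H" "{c, d} \<in> edges H"
    and disj: "{x, y} \<inter> {c, d} = {}"
  shows "{x, c} \<in> edges H \<or> {x, d} \<in> edges H \<or> {y, c} \<in> edges H \<or> {y, d} \<in> edges H"
proof (rule ccontr)
  assume neg: "\<not> ?thesis"
  have "x \<noteq> y" "c \<noteq> d" "{x, y, c, d} \<subseteq> verts H"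
    using H(2) e by (force simp: simple_graph_def)+
  moreover have "x \<noteq> c" "x \<noteq> d" "y \<noteq> c" "y \<noteq> d" using disj by auto
  moreover have "{y, x} \<in> edges H" "{d, c} \<in> edges H" using e by (simp_all add: insert_commute)
  moreover have "{c, x} \<notin> edges H" "{d, x} \<notin> edges H" "{c, y} \<notin> edges H" "{d, y} \<notin> edges H"
    using neg by (simp_all add: insert_commute)
  ultimately have "anticycle H [x, c, y, d]"
    using e neg by (simp add: anticycle_def All_less_Suc)
  then show False using H(1) by (auto simp: co_chordal_iff)
qed

text \<open>The edge \<open>xy\<close> prevents the added join of \<open>A\<close> and \<open>B\<close> and the pendant edges in \<open>W\<close> from taking part
  in any anticycle.  It matters for the application that \<open>A\<close> and \<open>B\<close> may be larger than the
  neighbourhoods of \<open>x\<close> and \<open>y\<close> in \<open>H\<close>: all new edges can go into a single member of a cover.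

  Suppose that the new graph contains an anticycle, and go round the underlying cycle, on which
  consecutive vertices are not adjacent.  Call a vertex outside if it is not in \<open>A \<union> B\<close>.  An edge
  between two outside vertices would be old and disjoint from \<open>xy\<close>, and an edge connecting it to
  \<open>xy\<close> would put one of its ends into \<open>A\<close> or \<open>B\<close>.  Hence outside vertices are pairwise nonadjacent,
  so any two of them are consecutive on the cycle.  A vertex in \<open>A \<inter> B\<close> would have two outside
  cycle neighbours, which are not consecutive.  If there were vertices \<open>a \<in> A\<close> and \<open>b \<in> B\<close>, then
  each of the two arcs between them would contain an outside vertex, since consecutive vertices
  cannot lie one in \<open>A\<close> and the other in \<open>B\<close>; but outside vertices on different arcs are not
  consecutive either.  So the anticycle uses no new edge and already lives in the old graph.\<close>

lemma co_chordal_join: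
  assumes H: "simple_graph H" "co_chordal H" and xy: "{x, y} \<in> edges H"
    and AB: "y \<in> A" "x \<in> B"
    and nbr_x: "\<And>u. {x, u} \<in> edges H \<Longrightarrow> u \<in> A"
    and nbr_y: "\<And>u. {y, u} \<in> edges H \<Longrightarrow> u \<in> B"
    and whisker: "\<And>d. d \<in> W \<Longrightarrow> \<exists>a w. d = {a, w} \<and> a \<in> A \<inter> B \<and> w \<notin> A \<union> B \<union> verts H"
    and edges: "edges K = edges H \<union> {{a, b} | a b. a \<in> A \<and> b \<in> B \<and> a \<noteq> b} \<union> W"
  shows "co_chordal K"
proof (rule ccontr)
  assume "\<not> co_chordal K"
  then obtain c where c: "anticycle K c" by (auto simp: co_chordal_iff)
  define n where "n = length c"
  define w where "w p = c ! (p mod n)" for p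
  have n: "4 \<le> n" using c by (simp add: anticycle_def n_def)
  have far: "{w p, w q} \<in> edges K" if "p + 2 \<le> q" "q + 2 \<le> p + n" for p q
    using anticycle_mod_edge[OF c, of "q - p" p] that by (simp add: w_def n_def)
  have near: "{w p, w (Suc p)} \<notin> edges K" "w p \<noteq> w (Suc p)" for p
    using anticycle_mod_nonedge[OF c] by (simp_all add: w_def n_def)
  have period: "w (p + n) = w p" for p by (simp add: w_def)

  have outside: "w p \<in> A \<union> B \<or> w q \<in> A \<union> B" if "p + 2 \<le> q" "q + 2 \<le> p + n" for p q
  proof (rule ccontr)
    assume out: "\<not> ?thesis"
    have "{w p, w q} \<in> edges H"
      using far[OF that] out unfolding edges by (auto dest!: whisker simp: doubleton_eq_iff)
    moreover have "{x, y} \<inter> {w p, w q} = {}" using out AB by auto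
    ultimately show False
      using co_chordal_two_edges[OF H(2,1) xy, of "w p" "w q"] nbr_x nbr_y out by blast
  qed
  have joined: "{a, b} \<in> edges K" if "a \<in> A" "b \<in> B" "a \<noteq> b" for a b
    using that unfolding edges by blast
  have AB_near: False if "w p \<in> A \<and> w (Suc p) \<in> B \<or> w p \<in> B \<and> w (Suc p) \<in> A" for p
    using near[of p] that joined[of "w p" "w (Suc p)"] joined[of "w (Suc p)" "w p"]
    by (auto simp: insert_commute)
  \<comment> \<open>The cycle neighbours of a vertex in \<open>A \<inter> B\<close> would both be outside.\<close>
  have not_both: "w p \<notin> A \<inter> B" for p
  proof
    assume p: "w p \<in> A \<inter> B"
    have "w (Suc p) \<notin> A \<union> B" using AB_near[of p] p by auto
    moreover have "w (p + n - 1) \<notin> A \<union> B"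
      using AB_near[of "p + n - 1"] p n period[of p] by auto
    moreover have "Suc p + 2 \<le> p + n - 1" "p + n - 1 + 2 \<le> Suc p + n" using n by auto
    ultimately show False using outside by blast
  qed
  \<comment> \<open>\<open>p\<close> and \<open>q\<close> cut the cycle into the arc from \<open>p\<close> to \<open>q\<close> and the arc from \<open>q\<close> to \<open>p + n\<close>.
    The first vertex \<open>r\<close> of the former that is not in \<open>A\<close> and the first vertex \<open>s\<close> of the latter
    that is not in \<open>B\<close> are outside and far apart.\<close>
  have not_join: False if pq: "p < q" "q < p + n" and "w p \<in> A" "w q \<in> B" for p q
  proof -
    have "p < q \<and> w q \<notin> A" using not_both[of q] pq \<open>w q \<in> B\<close> by auto
    then obtain r where r: "r \<le> q" "p < r" "w r \<notin> A" "\<forall>i < r. \<not> (p < i \<and> w i \<notin> A)"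
      using ex_least_nat_le[of "\<lambda>r. p < r \<and> w r \<notin> A" q] by blast
    have "w (r - 1) \<in> A"
      using r(2) r(4)[rule_format, of "r - 1"] \<open>w p \<in> A\<close> by (cases "r - 1 = p") auto
    then have rB: "w r \<notin> B" using AB_near[of "r - 1"] r(2) by auto
    have "q < p + n \<and> w (p + n) \<notin> B" using not_both[of p] pq \<open>w p \<in> A\<close> by (auto simp: period)
    then obtain s where s: "s \<le> p + n" "q < s" "w s \<notin> B" "\<forall>i < s. \<not> (q < i \<and> w i \<notin> B)"
      using ex_least_nat_le[of "\<lambda>s. q < s \<and> w s \<notin> B" "p + n"] by blast
    have "w (s - 1) \<in> B"
      using s(2) s(4)[rule_format, of "s - 1"] \<open>w q \<in> B\<close> by (cases "s - 1 = q") auto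
    then have sA: "w s \<notin> A" using AB_near[of "s - 1"] s(2) by auto
    have "r \<noteq> q" using rB \<open>w q \<in> B\<close> by auto
    moreover have "s \<noteq> p + n" using sA \<open>w p \<in> A\<close> period[of p] by auto
    ultimately have "r + 2 \<le> s" "s + 2 \<le> r + n" using r s by auto
    then show False using outside[of r s] r s rB sA by blast
  qed
  have old: "{w p, w q} \<in> edges H" if pq: "p < n" "q < n" "{w p, w q} \<in> edges K" for p q
  proof (rule ccontr)
    assume "{w p, w q} \<notin> edges H"
    then have "w p \<noteq> w q" and split: "w p \<in> A \<and> w q \<in> B \<or> w p \<in> B \<and> w q \<in> A"
      using pq(3) whisker[of "{w p, w q}"] not_both[of p] not_both[of q]
      unfolding edges by (auto simp: doubleton_eq_iff)
    then have "p < q \<or> q < p" by (metis nat_neq_iff)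
    then show False
      using split pq not_join[of p q] not_join[of q p] not_join[of p "q + n"] not_join[of q "p + n"]
      by (auto simp: period)
  qed
  \<comment> \<open>Every vertex of an anticycle is on an edge of it, and that edge is old.\<close>
  have "w p \<in> verts H" if "p < n" for p
  proof -
    have "{w p, w ((p + 2) mod n)} \<in> edges K" using far[of p "p + 2"] n by (simp add: w_def)
    then have "{w p, w ((p + 2) mod n)} \<in> edges H" using old[of p "(p + 2) mod n"] that n by simp
    then show ?thesis using H(1) by (auto simp: simple_graph_def)
  qed
  then have "set c \<subseteq> verts H"
    by (auto simp: in_set_conv_nth n_def w_def)
  moreover have "{c ! i, c ! j} \<in> edges K \<longleftrightarrow> {c ! i, c ! j} \<in> edges H" if "i < n" "j < n" for i j
    using old[of i j] that unfolding edges by (auto simp: w_def)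
  ultimately have "anticycle H c"
    using c by (simp add: anticycle_def n_def)
  then show False using H(2) by (auto simp: co_chordal_iff)
qed

section \<open>Co-chordal covers\<close>

text \<open>The polarization renames the vertex \<open>v\<close> to \<open>(v, 1)\<close>, so a cover of the original graph has to
  be transported along an injection.\<close>

definition map_graph :: "('a \<Rightarrow> 'b) \<Rightarrow> 'a ugraph \<Rightarrow> 'b ugraph" where
  "map_graph f G = \<lparr>verts = f ` verts G, edges = (`) f ` edges G\<rparr>"

lemma doubleton_in_edges_map_graph:
  assumes "inj f"
  shows "{f u, f v} \<in> edges (map_graph f G) \<longleftrightarrow> {u, v} \<in> edges G"
proof -
  have "{f u, f v} = f ` {u, v}" by simp
  then show ?thesis using assms by (auto simp: map_graph_def inj_image_eq_iff simp del: image_insert)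
qed

lemma simple_graph_map_graph:
  assumes "inj f" "simple_graph G"
  shows "simple_graph (map_graph f G)"
  using assms by (auto simp: simple_graph_def map_graph_def card_image inj_on_subset)

lemma co_chordal_map_graph:
  assumes f: "inj f" and G: "co_chordal G"
  shows "co_chordal (map_graph f G)"
  unfolding co_chordal_iff
proof
  assume "\<exists>c. anticycle (map_graph f G) c"
  then obtain c where c: "anticycle (map_graph f G) c" ..
  then have "set c \<subseteq> f ` verts G" by (simp add: anticycle_def map_graph_def)
  then have "\<forall>v \<in> set c. \<exists>u. u \<in> verts G \<and> v = f u" by auto
  then obtain g where g: "\<forall>v \<in> set c. g v \<in> verts G \<and> v = f (g v)" by metis
  define c' where "c' = map g c"
  have c': "c = map f c'" "set c' \<subseteq> verts G"
    using g by (auto simp: c'_def intro!: map_idI[symmetric])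
  have "anticycle G c'"
    using c c' by (auto simp: anticycle_def distinct_map doubleton_in_edges_map_graph[OF f])
  then show False using G by (auto simp: co_chordal_iff)
qed

lemma co_chordal_single_edge: "card d = 2 \<Longrightarrow> co_chordal \<lparr>verts = d, edges = {d}\<rparr>"
proof -
  assume d: "card d = 2"
  have "length c \<le> 2" if "distinct c" "set c \<subseteq> d" for c
    using that d card_mono[of d "set c"] by (simp add: distinct_card card_ge_0_finite)
  then show ?thesis by (force simp: co_chordal_iff anticycle_def)
qed

definition co_chordal_cover :: "'a ugraph \<Rightarrow> nat \<Rightarrow> (nat \<Rightarrow> 'a ugraph) \<Rightarrow> bool" where
  "co_chordal_cover G n H \<longleftrightarrow>
     (\<forall>i < n. subgraph_of (H i) G \<and> co_chordal (H i)) \<and> edges G = (\<Union>i < n. edges (H i))"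

lemma co_chord_eq_Least: "co_chord G = (LEAST n. \<exists>H. co_chordal_cover G n H)"
  by (simp add: co_chord_def co_chordal_cover_def)

lemma co_chord_le: "co_chordal_cover G n H \<Longrightarrow> co_chord G \<le> n"
  unfolding co_chord_eq_Least by (rule Least_le) blast

text \<open>Single edges cover the graph, so the minimum in the definition is one over a nonempty set.\<close>

lemma co_chord_attained:
  assumes G: "finite_simple_graph G"
  obtains H where "co_chordal_cover G (co_chord G) H"
proof -
  have "edges G \<subseteq> Pow (verts G)" "finite (verts G)"
    using G by (auto simp: finite_simple_graph_def simple_graph_def)
  then have "finite (edges G)" by (meson finite_Pow_iff finite_subset)
  then obtain f and m :: nat where f: "edges G = f ` {i. i < m}"
    using finite_imp_nat_seg_image_inj_on[of "edges G"] by metis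
  have edge: "f i \<in> edges G" "f i \<subseteq> verts G" "card (f i) = 2" if "i < m" for i
    using G f that by (auto simp: finite_simple_graph_def simple_graph_def)
  have "co_chordal_cover G m (\<lambda>i. \<lparr>verts = f i, edges = {f i}\<rparr>)"
    unfolding co_chordal_cover_def
    using edge f by (auto simp: co_chordal_single_edge subgraph_of_def simple_graph_def)
  then have "\<exists>H. co_chordal_cover G (co_chord G) H"
    unfolding co_chord_eq_Least by (intro LeastI[of "\<lambda>n. \<exists>H. co_chordal_cover G n H" m] exI)
  then show ?thesis using that by blast
qed

section \<open>Monomials and monomial ideals\<close>

abbreviation mono_le :: "'x monomial \<Rightarrow> 'x monomial \<Rightarrow> bool" where
  "mono_le m m' \<equiv> \<forall>v. Poly_Mapping.lookup m v \<le> Poly_Mapping.lookup m' v"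

abbreviation pair_monomial :: "'x \<Rightarrow> 'x \<Rightarrow> 'x monomial" where
  "pair_monomial u v \<equiv> Poly_Mapping.single u 1 + Poly_Mapping.single v 1"

lemma mono_le_add_diff:
  assumes "mono_le m m'"
  shows "m + (m' - m) = m'"
  using assms by (intro poly_mapping_eqI) (simp add: lookup_add lookup_minus)

lemma mono_le_antisym:
  assumes "mono_le m m'" "mono_le m' m"
  shows "m = m'"
  using assms by (intro poly_mapping_eqI) (simp add: order_antisym)

lemma keys_add_monomial:
  "Poly_Mapping.keys (m + m' :: 'x monomial) = Poly_Mapping.keys m \<union> Poly_Mapping.keys m'"
  by (auto simp: in_keys_iff lookup_add)

text \<open>All monomials of interest are products of two variables, and between monomials of the same
  degree divisibility is equality.\<close>

lemma mono_le_pair_monomial_iff: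
  "mono_le (pair_monomial u v) (pair_monomial a b) \<longleftrightarrow> {u, v} = {a, b}"
proof
  assume le: "mono_le (pair_monomial u v) (pair_monomial a b)"
  show "{u, v} = {a, b}"
    using le[rule_format, of u] le[rule_format, of v]
    by (auto simp: lookup_add lookup_single when_def insert_commute split: if_splits)
next
  assume "{u, v} = {a, b}"
  then have "pair_monomial u v = pair_monomial a b"
    by (elim doubleton_eq_iff[THEN iffD1, elim_format]) (auto simp: add.commute)
  then show "mono_le (pair_monomial u v) (pair_monomial a b)" by simp
qed

lemma edge_monomial_pair: "u \<noteq> v \<Longrightarrow> edge_monomial {u, v} = pair_monomial u v"
  by (simp add: edge_monomial_def)

lemma polarize_pair_monomial:
  "polarize_monomial (pair_monomial u v)
     = (if u = v then pair_monomial (u, 1) (u, 2) else pair_monomial (u, 1) (v, 1))"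
proof -
  have "Poly_Mapping.keys (pair_monomial u v) = {u, v}"
    by (auto simp: keys_add_monomial)
  then show ?thesis
    by (auto simp: polarize_monomial_def lookup_add lookup_single when_def numeral_2_eq_2 insert_commute)
qed

lemma keys_mono_poly [simp]: "Poly_Mapping.keys (mono_poly m :: ('x, 'k::field) mpoly) = {m}"
  by (simp add: mono_poly_def)

lemma mono_poly_mult: "mono_poly m * mono_poly m' = (mono_poly (m + m') :: ('x, 'k::field) mpoly)"
  by (simp add: mono_poly_def mult_single)

lemma mpoly_ring_simps [simp]:
  "mult (mpoly_ring V) = (*)" "one (mpoly_ring V) = 1"
  "zero (mpoly_ring V) = 0" "add (mpoly_ring V) = (+)"
  by (simp_all add: mpoly_ring_def)

lemma carrier_mpoly_ring:
  "f \<in> carrier (mpoly_ring V) \<longleftrightarrow> (\<forall>m \<in> Poly_Mapping.keys f. Poly_Mapping.keys m \<subseteq> V)"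
  by (simp add: mpoly_ring_def)

lemma mono_poly_in_carrier [simp]:
  "(mono_poly m :: ('x, 'k::field) mpoly) \<in> carrier (mpoly_ring V) \<longleftrightarrow> Poly_Mapping.keys m \<subseteq> V"
  by (simp add: carrier_mpoly_ring)

lemma cring_mpoly_ring: "cring (mpoly_ring V :: ('x, 'k::field) mpoly ring)"
proof (intro cringI abelian_groupI comm_monoidI)
  fix f g :: "('x, 'k) mpoly"
  assume fg: "f \<in> carrier (mpoly_ring V)" "g \<in> carrier (mpoly_ring V)"
  show "f \<oplus>\<^bsub>mpoly_ring V\<^esub> g \<in> carrier (mpoly_ring V)"
    using fg keys_add[of f g] by (auto simp: carrier_mpoly_ring)
  show "f \<otimes>\<^bsub>mpoly_ring V\<^esub> g \<in> carrier (mpoly_ring V)"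
    using fg keys_mult[of f g] by (fastforce simp: carrier_mpoly_ring keys_add_monomial)
  show "\<exists>h \<in> carrier (mpoly_ring V). h \<oplus>\<^bsub>mpoly_ring V\<^esub> f = \<zero>\<^bsub>mpoly_ring V\<^esub>"
    using fg by (intro bexI[of _ "- f"]) (auto simp: carrier_mpoly_ring in_keys_iff)
qed (auto simp: carrier_mpoly_ring algebra_simps)

text \<open>The ideal generated by a set of monomials, described by the monomials occurring in its
  elements.  With this description membership can be bounded from above: it is closed under the
  operations that build the generated ideal and the product ideal.\<close>

definition mono_span :: "'x set \<Rightarrow> 'x monomial set \<Rightarrow> ('x, 'k::field) mpoly set" where
  "mono_span V S =
     {f \<in> carrier (mpoly_ring V). \<forall>m \<in> Poly_Mapping.keys f. \<exists>g \<in> S. mono_le g m}"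

lemma mono_poly_in_mono_span [simp]:
  "(mono_poly m :: ('x, 'k::field) mpoly) \<in> mono_span V S
     \<longleftrightarrow> Poly_Mapping.keys m \<subseteq> V \<and> (\<exists>g \<in> S. mono_le g m)"
  by (simp add: mono_span_def)

lemma mono_span_add:
  assumes "f \<in> mono_span V S" "g \<in> mono_span V S"
  shows "f + g \<in> mono_span V S"
  using assms keys_add[of f g] by (fastforce simp: mono_span_def carrier_mpoly_ring)

lemma mono_span_mult:
  assumes "f \<in> mono_span V S" "g \<in> mono_span V T"
  shows "f * g \<in> mono_span V {a + b | a b. a \<in> S \<and> b \<in> T}"
proof -
  have "Poly_Mapping.keys m \<subseteq> V \<and> (\<exists>g \<in> {a + b | a b. a \<in> S \<and> b \<in> T}. mono_le g m)"
    if "m \<in> Poly_Mapping.keys (f * g)" for m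
  proof -
    obtain p q where pq: "p \<in> Poly_Mapping.keys f" "q \<in> Poly_Mapping.keys g" "m = p + q"
      using \<open>m \<in> Poly_Mapping.keys (f * g)\<close> keys_mult[of f g] by blast
    obtain a b where "a \<in> S" "b \<in> T" "mono_le a p" "mono_le b q"
      using assms pq unfolding mono_span_def by blast
    then have "a + b \<in> {a + b | a b. a \<in> S \<and> b \<in> T}" "mono_le (a + b) m"
      using pq(3) by (auto simp: lookup_add intro: add_mono)
    moreover have "Poly_Mapping.keys m \<subseteq> V"
      using assms pq by (auto simp: mono_span_def carrier_mpoly_ring keys_add_monomial)
    ultimately show ?thesis by blast
  qed
  then show ?thesis by (auto simp: mono_span_def carrier_mpoly_ring)
qed

lemma ideal_mono_span: "ideal (mono_span V S :: ('x, 'k::field) mpoly set) (mpoly_ring V)"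
proof -
  interpret cring "mpoly_ring V :: ('x, 'k) mpoly ring" by (rule cring_mpoly_ring)
  have absorb: "f * g \<in> mono_span V S"
    if f: "f \<in> mono_span V S" and g: "g \<in> carrier (mpoly_ring V)" for f g :: "('x, 'k) mpoly"
  proof -
    have "g \<in> mono_span V {0}" using g by (simp add: mono_span_def)
    from mono_span_mult[OF f this] show ?thesis by simp
  qed
  have neg: "\<ominus>\<^bsub>mpoly_ring V\<^esub> f = - f" if "f \<in> carrier (mpoly_ring V)" for f :: "('x, 'k) mpoly"
    using that by (intro minus_equality) (auto simp: carrier_mpoly_ring in_keys_iff)
  have "subgroup (mono_span V S :: ('x, 'k) mpoly set) (add_monoid (mpoly_ring V))"
  proof (rule add.subgroupI)
    show "mono_span V S \<subseteq> carrier (mpoly_ring V)" by (auto simp: mono_span_def)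
    have "(0 :: ('x, 'k) mpoly) \<in> mono_span V S" by (simp add: mono_span_def carrier_mpoly_ring)
    then show "mono_span V S \<noteq> ({} :: ('x, 'k) mpoly set)" by blast
  next
    fix f g :: "('x, 'k) mpoly"
    assume f: "f \<in> mono_span V S" and g: "g \<in> mono_span V S"
    then show "f \<oplus>\<^bsub>mpoly_ring V\<^esub> g \<in> mono_span V S" by (simp add: mono_span_add)
    have "f \<in> carrier (mpoly_ring V)" using f by (simp add: mono_span_def)
    then show "\<ominus>\<^bsub>mpoly_ring V\<^esub> f \<in> mono_span V S"
      using f by (auto simp: neg mono_span_def carrier_mpoly_ring in_keys_iff)
  qed
  then show ?thesis
    using absorb by (intro idealI) (auto simp: ring_axioms mult.commute)
qed

lemma mono_poly_in_genideal_iff: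
  assumes "\<forall>g \<in> S. Poly_Mapping.keys g \<subseteq> V"
  shows "(mono_poly m :: ('x, 'k::field) mpoly) \<in> genideal (mpoly_ring V) (mono_poly ` S)
           \<longleftrightarrow> Poly_Mapping.keys m \<subseteq> V \<and> (\<exists>g \<in> S. mono_le g m)"
  and "genideal (mpoly_ring V) (mono_poly ` S) \<subseteq> (mono_span V S :: ('x, 'k) mpoly set)"
proof -
  let ?I = "genideal (mpoly_ring V) (mono_poly ` S) :: ('x, 'k) mpoly set"
  interpret cring "mpoly_ring V :: ('x, 'k) mpoly ring" by (rule cring_mpoly_ring)
  have gens: "mono_poly ` S \<subseteq> carrier (mpoly_ring V :: ('x, 'k) mpoly ring)"
    using assms by auto
  interpret I: ideal ?I "mpoly_ring V" by (rule genideal_ideal[OF gens])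
  have "mono_poly ` S \<subseteq> (mono_span V S :: ('x, 'k) mpoly set)" using assms by auto
  then show sub: "?I \<subseteq> mono_span V S"
    by (rule genideal_minimal[OF ideal_mono_span])
  have "mono_poly m \<in> ?I" if m: "Poly_Mapping.keys m \<subseteq> V" and g: "g \<in> S" "mono_le g m" for g
  proof -
    have "Poly_Mapping.keys (m - g) \<subseteq> V"
      using m by (auto simp: in_keys_iff lookup_minus)
    then have "mono_poly (m - g) \<otimes>\<^bsub>mpoly_ring V\<^esub> mono_poly g \<in> ?I"
      using genideal_self[OF gens] g(1) by (intro I.I_l_closed) auto
    then show ?thesis
      using mono_le_add_diff[OF g(2)] by (simp add: mono_poly_mult add.commute)
  qed
  then show "mono_poly m \<in> ?I \<longleftrightarrow> Poly_Mapping.keys m \<subseteq> V \<and> (\<exists>g \<in> S. mono_le g m)"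
    using subsetD[OF sub, of "mono_poly m"] unfolding mono_poly_in_mono_span by blast
qed

text \<open>The product ideal consists of sums of products, and the supports of these are controlled by
  the product of the spans; conversely a multiple of \<open>g h\<close> splits as \<open>g\<close> times a multiple of \<open>h\<close>.\<close>

lemma mono_poly_in_genideal_square_iff:
  assumes gens: "\<forall>g \<in> S. Poly_Mapping.keys g \<subseteq> V"
    and I: "I = genideal (mpoly_ring V) (mono_poly ` S)"
  shows "(mono_poly m :: ('x, 'k::field) mpoly) \<in> ideal_prod (mpoly_ring V) I I
           \<longleftrightarrow> Poly_Mapping.keys m \<subseteq> V \<and> (\<exists>g \<in> S. \<exists>h \<in> S. mono_le (g + h) m)"
proof
  have "f \<in> mono_span V {a + b | a b. a \<in> S \<and> b \<in> S}"
    if "f \<in> ideal_prod (mpoly_ring V) I I" for f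
    using that
  proof induction
    case (prod i j)
    then have "i \<in> mono_span V S" "j \<in> mono_span V S"
      using mono_poly_in_genideal_iff(2)[OF gens] I by blast+
    then show ?case by (simp add: mono_span_mult)
  next
    case (sum s1 s2)
    then show ?case by (simp add: mono_span_add)
  qed
  moreover assume "mono_poly m \<in> ideal_prod (mpoly_ring V) I I"
  ultimately have "mono_poly m \<in> (mono_span V {a + b | a b. a \<in> S \<and> b \<in> S} :: ('x, 'k) mpoly set)"
    by blast
  then show "Poly_Mapping.keys m \<subseteq> V \<and> (\<exists>g \<in> S. \<exists>h \<in> S. mono_le (g + h) m)"
    unfolding mono_poly_in_mono_span by blast
next
  assume "Poly_Mapping.keys m \<subseteq> V \<and> (\<exists>g \<in> S. \<exists>h \<in> S. mono_le (g + h) m)"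
  then obtain g h where m: "Poly_Mapping.keys m \<subseteq> V" and gh: "g \<in> S" "h \<in> S" "mono_le (g + h) m"
    by blast
  have m_eq: "m = g + (m - g)" and "mono_le h (m - g)"
    using gh(3) by (auto intro!: poly_mapping_eqI simp: lookup_add lookup_minus)
       (metis add_leE le_add_diff_inverse, metis add_le_imp_le_diff add.commute)
  moreover have "Poly_Mapping.keys (m - g) \<subseteq> V"
    using m by (auto simp: in_keys_iff lookup_minus)
  ultimately have "mono_poly g \<in> I" "mono_poly (m - g) \<in> I"
    using gh gens by (auto simp: I mono_poly_in_genideal_iff(1)[OF gens])
  then have "mono_poly g \<otimes>\<^bsub>mpoly_ring V\<^esub> mono_poly (m - g) \<in> ideal_prod (mpoly_ring V) I I"
    by (rule ideal_prod.prod)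
  then show "mono_poly m \<in> ideal_prod (mpoly_ring V) I I"
    using m_eq by (simp add: mono_poly_mult)
qed

section \<open>The colon ideal and its polarization\<close>

text \<open>The quadratic generators of \<open>(I(G)\<^sup>2 : xy)\<close> are the products \<open>u v\<close> with \<open>uv\<close> an edge, or with
  \<open>u\<close> a neighbour of \<open>x\<close> and \<open>v\<close> a neighbour of \<open>y\<close>; in the second case \<open>u = v\<close> is possible and gives
  a square.\<close>

definition colon_pair :: "'a ugraph \<Rightarrow> 'a \<Rightarrow> 'a \<Rightarrow> 'a \<Rightarrow> 'a \<Rightarrow> bool" where
  "colon_pair G x y u v \<longleftrightarrow> {u, v} \<in> edges G \<or> {x, u} \<in> edges G \<and> {y, v} \<in> edges G"

lemma simple_graph_edgeE:
  assumes "simple_graph G" "d \<in> edges G"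
  obtains u v where "d = {u, v}" "u \<noteq> v" "u \<in> verts G" "v \<in> verts G"
  using assms by (auto simp: simple_graph_def card_2_iff)

lemma keys_edge_monomial: "card d = 2 \<Longrightarrow> Poly_Mapping.keys (edge_monomial d) = d"
  by (auto simp: card_2_iff edge_monomial_pair keys_add_monomial)

lemma mono_le_edge_monomial_iff:
  assumes "card d = 2" "card d' = 2"
  shows "mono_le (edge_monomial d) (edge_monomial d') \<longleftrightarrow> d = d'"
proof -
  obtain u v where d: "d = {u, v}" "u \<noteq> v" using assms(1) by (auto simp: card_2_iff)
  obtain a b where d': "d' = {a, b}" "a \<noteq> b" using assms(2) by (auto simp: card_2_iff)
  show ?thesis
    using mono_le_pair_monomial_iff[of u v a b] unfolding d(1) d'(1)
    by (simp only: edge_monomial_pair[OF d(2)] edge_monomial_pair[OF d'(2)])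
qed

lemma colon_pair_vertices:
  assumes "simple_graph G" "colon_pair G x y u v"
  shows "u \<in> verts G" "v \<in> verts G"
  using assms by (auto simp: colon_pair_def simple_graph_def)

text \<open>The case of a single edge of Banerjee's description of colon ideals.  Suppose that \<open>d d'\<close>
  divides \<open>m x y\<close>.  If \<open>d\<close> avoids \<open>x\<close> and \<open>y\<close>, it divides \<open>m\<close>; if \<open>d\<close> is \<open>xy\<close>, then \<open>d'\<close> divides \<open>m\<close>.
  Otherwise both edges meet \<open>xy\<close> in one vertex.  If it is the same vertex, say \<open>d = xu\<close> and
  \<open>d' = xv\<close>, then cancelling leaves one \<open>x\<close> besides \<open>u\<close>, so \<open>d\<close> divides \<open>m\<close>.  If \<open>d = xu\<close> and
  \<open>d' = yv\<close>, then \<open>u v\<close> divides \<open>m\<close>.\<close>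

lemma colon_pair_if_two_edges_le:
  assumes G: "simple_graph G" and xy: "{x, y} \<in> edges G"
    and d: "d \<in> edges G" "d' \<in> edges G"
    and le: "mono_le (edge_monomial d + edge_monomial d') (m + pair_monomial x y)"
  shows "\<exists>u v. colon_pair G x y u v \<and> mono_le (pair_monomial u v) m"
proof -
  have avoiding: ?thesis
    if d: "d \<in> edges G" "d \<inter> {x, y} = {}"
      and le: "mono_le (edge_monomial d + edge_monomial d') (m + pair_monomial x y)" for d d'
  proof -
    obtain a b where ab: "d = {a, b}" "a \<noteq> b" using simple_graph_edgeE[OF G d(1)] by metis
    have "mono_le (pair_monomial a b) m"
    proof
      fix w
      show "Poly_Mapping.lookup (pair_monomial a b) w \<le> Poly_Mapping.lookup m w"
        using le[rule_format, of w] d(2) ab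
        by (auto simp: edge_monomial_pair lookup_add lookup_single when_def split: if_splits)
    qed
    then show ?thesis using d ab by (auto simp: colon_pair_def)
  qed
  have equal: ?thesis
    if d: "d \<in> edges G"
      and le: "mono_le (edge_monomial d + edge_monomial {x, y}) (m + pair_monomial x y)" for d
  proof -
    obtain a b where ab: "d = {a, b}" "a \<noteq> b" using simple_graph_edgeE[OF G d(1)] by metis
    have "x \<noteq> y" using simple_graph_edgeE[OF G xy] by (metis doubleton_eq_iff)
    then have "mono_le (pair_monomial a b) m"
      using le ab by (simp add: edge_monomial_pair lookup_add)
    then show ?thesis using d ab by (auto simp: colon_pair_def)
  qed
  have meet: "d \<inter> {x, y} = {} \<or> d = {x, y} \<or> (\<exists>p u. d = {p, u} \<and> p \<in> {x, y} \<and> u \<notin> {x, y})"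
    if d: "d \<in> edges G" for d
  proof -
    obtain a b where "d = {a, b}" "a \<noteq> b" using simple_graph_edgeE[OF G d] by metis
    moreover from this have "d = {b, a}" by auto
    ultimately show ?thesis by (cases "a \<in> {x, y}"; cases "b \<in> {x, y}") auto
  qed
  have le': "mono_le (edge_monomial d' + edge_monomial d) (m + pair_monomial x y)"
    using le by (simp add: add.commute)
  consider "d \<inter> {x, y} = {} \<or> d' \<inter> {x, y} = {}" | "d = {x, y} \<or> d' = {x, y}"
    | (both) p u q v where "d = {p, u}" "p \<in> {x, y}" "u \<notin> {x, y}"
        "d' = {q, v}" "q \<in> {x, y}" "v \<notin> {x, y}"
    using meet[OF d(1)] meet[OF d(2)] by (elim disjE exE conjE) blast+
  then show ?thesis
  proof cases
    case 1
    then show ?thesis using avoiding[OF d(1) _ le] avoiding[OF d(2) _ le'] by blast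
  next
    case 2
    then show ?thesis using equal[OF d(1)] equal[OF d(2)] le le' by metis
  next
    case both
    then have "p \<noteq> u" "q \<noteq> v" by auto
    then have le: "Poly_Mapping.lookup (pair_monomial p u + pair_monomial q v) w
        \<le> Poly_Mapping.lookup (m + pair_monomial x y) w" for w
      using le both by (simp add: edge_monomial_pair)
    have "x \<noteq> y" using simple_graph_edgeE[OF G xy] by (metis doubleton_eq_iff)
    show ?thesis
    proof (cases "p = q")
      case True
      have "mono_le (pair_monomial p u) m"
      proof
        fix w
        show "Poly_Mapping.lookup (pair_monomial p u) w \<le> Poly_Mapping.lookup m w"
          using le[of w] both True \<open>x \<noteq> y\<close>
          by (auto simp: lookup_add lookup_single when_def split: if_splits)
      qed
      then show ?thesis using d both by (auto simp: colon_pair_def)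
    next
      case False
      have uv: "mono_le (pair_monomial u v) m"
      proof
        fix w
        show "Poly_Mapping.lookup (pair_monomial u v) w \<le> Poly_Mapping.lookup m w"
          using le[of w] both
          by (auto simp: lookup_add lookup_single when_def split: if_splits)
      qed
      then have "mono_le (pair_monomial v u) m" by (simp add: add.commute)
      moreover have "colon_pair G x y u v \<or> colon_pair G x y v u"
        using both False d by (auto simp: colon_pair_def)
      ultimately show ?thesis using uv by blast
    qed
  qed
qed

text \<open>For the converse of the preceding lemma, \<open>u v x y\<close> is a product of two edges, either as
  \<open>(uv)(xy)\<close> or as \<open>(xu)(yv)\<close>.\<close>

lemma mono_poly_in_colon_iff:
  fixes G :: "'a ugraph" and I :: "('a, 'k::field) mpoly set"
  assumes G: "simple_graph G" and xy: "{x, y} \<in> edges G" and I: "I = edge_ideal G"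
  shows "mono_poly m \<in> colon_ideal (mpoly_ring (verts G)) (ideal_prod (mpoly_ring (verts G)) I I)
             (mono_poly (edge_monomial {x, y}))
           \<longleftrightarrow> Poly_Mapping.keys m \<subseteq> verts G
               \<and> (\<exists>u v. colon_pair G x y u v \<and> mono_le (pair_monomial u v) m)"
proof -
  have xy': "x \<noteq> y" "x \<in> verts G" "y \<in> verts G"
    using G xy by (auto simp: simple_graph_def)
  have em: "\<forall>g \<in> edge_monomial ` edges G. Poly_Mapping.keys g \<subseteq> verts G"
    using G by (simp add: keys_edge_monomial simple_graph_def)
  have I': "I = genideal (mpoly_ring (verts G)) (mono_poly ` edge_monomial ` edges G)"
    by (simp add: I edge_ideal_def image_image)
  have "mono_poly m \<in> colon_ideal (mpoly_ring (verts G)) (ideal_prod (mpoly_ring (verts G)) I I)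
             (mono_poly (edge_monomial {x, y}))
     \<longleftrightarrow> Poly_Mapping.keys m \<subseteq> verts G \<and> mono_poly (m + pair_monomial x y) \<in> ideal_prod (mpoly_ring (verts G)) I I"
    by (simp add: colon_ideal_def mono_poly_mult edge_monomial_pair[OF xy'(1)])
  also have "\<dots> \<longleftrightarrow> Poly_Mapping.keys m \<subseteq> verts G \<and> (\<exists>d \<in> edges G. \<exists>d' \<in> edges G.
      mono_le (edge_monomial d + edge_monomial d') (m + pair_monomial x y))"
    using xy' by (subst mono_poly_in_genideal_square_iff[OF em I']) (auto simp: keys_add_monomial)
  also have "\<dots> \<longleftrightarrow> Poly_Mapping.keys m \<subseteq> verts G
               \<and> (\<exists>u v. colon_pair G x y u v \<and> mono_le (pair_monomial u v) m)"
  proof -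
    have "\<exists>d \<in> edges G. \<exists>d' \<in> edges G.
        mono_le (edge_monomial d + edge_monomial d') (m + pair_monomial x y)"
      if uv: "colon_pair G x y u v" and le: "mono_le (pair_monomial u v) m" for u v
    proof -
      have "\<exists>d \<in> edges G. \<exists>d' \<in> edges G.
          edge_monomial d + edge_monomial d' = pair_monomial u v + pair_monomial x y"
        using uv unfolding colon_pair_def
      proof
        assume "{u, v} \<in> edges G"
        moreover from this have "u \<noteq> v" using G by (auto simp: simple_graph_def)
        ultimately show ?thesis
          using xy xy'(1) by (intro bexI[of _ "{u, v}"] bexI[of _ "{x, y}"]) (simp_all add: edge_monomial_pair)
      next
        assume e: "{x, u} \<in> edges G \<and> {y, v} \<in> edges G"
        moreover from this have "x \<noteq> u" "y \<noteq> v" using G by (auto simp: simple_graph_def)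
        ultimately show ?thesis
          by (intro bexI[of _ "{x, u}"] bexI[of _ "{y, v}"]) (simp_all add: edge_monomial_pair algebra_simps)
      qed
      then obtain d d' where "d \<in> edges G" "d' \<in> edges G"
        "edge_monomial d + edge_monomial d' = pair_monomial u v + pair_monomial x y" by blast
      moreover have "mono_le (pair_monomial u v + pair_monomial x y) (m + pair_monomial x y)"
        using le by (simp add: lookup_add)
      ultimately show ?thesis by metis
    qed
    then show ?thesis using colon_pair_if_two_edges_le[OF G xy] by blast
  qed
  finally show ?thesis .
qed

lemma min_mono_gens_eq:
  fixes J :: "('x, 'k::field) mpoly set"
  assumes J: "\<And>m. mono_poly m \<in> J \<longleftrightarrow> Poly_Mapping.keys m \<subseteq> V \<and> (\<exists>q \<in> Q. mono_le q m)"
    and Q: "\<And>q. q \<in> Q \<Longrightarrow> Poly_Mapping.keys q \<subseteq> V"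
    and antichain: "\<And>q q'. q \<in> Q \<Longrightarrow> q' \<in> Q \<Longrightarrow> mono_le q' q \<Longrightarrow> q' = q"
  shows "min_mono_gens J = Q"
proof (intro equalityI subsetI)
  fix m assume m: "m \<in> min_mono_gens J"
  then obtain q where q: "q \<in> Q" "mono_le q m"
    using J[of m] unfolding min_mono_gens_def by blast
  moreover have "mono_poly q \<in> J" using J[of q] Q[OF q(1)] q(1) by blast
  ultimately show "m \<in> Q" using m by (auto simp: min_mono_gens_def)
next
  fix q assume q: "q \<in> Q"
  have "m' = q" if m': "mono_poly m' \<in> J" "mono_le m' q" for m'
  proof -
    obtain q' where q': "q' \<in> Q" "mono_le q' m'" using J[of m'] m'(1) by blast
    have "mono_le q' q" using q'(2) m'(2) order_trans by blast
    with antichain q q'(1) have "q' = q" by blast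
    with q' m' show ?thesis by (intro mono_le_antisym) auto
  qed
  moreover have "mono_poly q \<in> J" using J[of q] Q[OF q] q by blast
  ultimately show "q \<in> min_mono_gens J" by (auto simp: min_mono_gens_def)
qed

text \<open>The product \<open>u v\<close> polarizes to \<open>(u, 1) (v, 1)\<close>, and the square \<open>u\<^sup>2\<close> to an edge from \<open>(u, 1)\<close> to a
  new vertex \<open>(u, 2)\<close>.\<close>

definition polarized_edge :: "'a \<Rightarrow> 'a \<Rightarrow> ('a \<times> nat) set" where
  "polarized_edge u v = (if u = v then {(u, 1), (u, 2)} else {(u, 1), (v, 1)})"

lemma card_polarized_edge: "card (polarized_edge u v) = 2"
  by (simp add: polarized_edge_def)

lemma polarize_pair_monomial_eq:
  "polarize_monomial (pair_monomial u v) = edge_monomial (polarized_edge u v)"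
  unfolding polarize_pair_monomial polarized_edge_def by (simp add: edge_monomial_pair)

text \<open>The products described by \<open>colon_pair\<close> all have degree two, so none properly divides another and
  they are exactly the minimal generators.  Their polarizations are edges, and an edge is a multiple
  of another edge only if they are equal, so no further edges arise from the ideal.\<close>

lemma edges_polarized_colon_graph:
  fixes G :: "'a ugraph" and I J :: "('a, 'k::field) mpoly set"
  assumes G: "simple_graph G" and xy: "{x, y} \<in> edges G" and I: "I = edge_ideal G"
    and J: "J = colon_ideal (mpoly_ring (verts G))
               (ideal_prod (mpoly_ring (verts G)) I I) (mono_poly (edge_monomial {x, y}))"
    and G': "G' = graph_of_ideal (polarization_vars (verts G) J) (polarization (verts G) J)"
  shows "edges G' = {polarized_edge u v | u v. colon_pair G x y u v}"
    and "verts G' = verts G \<times> {1} \<union> \<Union> (edges G')"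
proof -
  define Q where "Q = {pair_monomial u v | u v. colon_pair G x y u v}"
  define P where "P = {polarized_edge u v | u v. colon_pair G x y u v}"
  let ?W = "polarization_vars (verts G) J"
  have gens: "min_mono_gens J = Q"
  proof (rule min_mono_gens_eq)
    show "mono_poly m \<in> J \<longleftrightarrow> Poly_Mapping.keys m \<subseteq> verts G \<and> (\<exists>q \<in> Q. mono_le q m)" for m
      unfolding J mono_poly_in_colon_iff[OF G xy I] Q_def by blast
  next
    fix q assume "q \<in> Q"
    then show "Poly_Mapping.keys q \<subseteq> verts G"
      using colon_pair_vertices[OF G] by (auto simp: Q_def keys_add_monomial)
  next
    fix q q' assume "q \<in> Q" "q' \<in> Q" and le: "mono_le q' q"
    then obtain u v a b where q: "q = pair_monomial u v" and q': "q' = pair_monomial a b"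
      by (auto simp: Q_def)
    have "{u, v} = {a, b}" using le mono_le_pair_monomial_iff[of a b u v] unfolding q q' by blast
    then show "q' = q" unfolding q q' using mono_le_pair_monomial_iff mono_le_antisym by metis
  qed
  have pol: "polarize_monomial ` Q = edge_monomial ` P"
  proof -
    have "polarize_monomial ` Q = {polarize_monomial (pair_monomial u v) | u v. colon_pair G x y u v}"
      unfolding Q_def by blast
    also have "\<dots> = edge_monomial ` P"
      unfolding polarize_pair_monomial_eq P_def by blast
    finally show ?thesis .
  qed
  have card_P: "card d = 2" if "d \<in> P" for d
    using that by (auto simp: P_def card_polarized_edge)
  have "(\<Union>m \<in> Q. Poly_Mapping.keys (polarize_monomial m)) = (\<Union>d \<in> P. Poly_Mapping.keys (edge_monomial d))"
    using arg_cong[OF pol, of "\<lambda>S. \<Union>m \<in> S. Poly_Mapping.keys m"] by simp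
  also have "\<dots> = \<Union>P" using card_P by (simp add: keys_edge_monomial)
  finally have W: "?W = verts G \<times> {1} \<union> \<Union>P" by (simp add: polarization_vars_def gens)
  have polarization: "polarization (verts G) J
      = genideal (mpoly_ring ?W) (mono_poly ` edge_monomial ` P)"
    by (simp add: polarization_def gens pol[symmetric] image_image)
  have P_W: "d \<subseteq> ?W" if "d \<in> P" for d using that W by blast
  have keys: "\<forall>g \<in> edge_monomial ` P. Poly_Mapping.keys g \<subseteq> ?W"
    using P_W card_P by (auto simp: keys_edge_monomial)
  have member: "mono_poly (edge_monomial d) \<in> polarization (verts G) J \<longleftrightarrow> d \<in> P"
    if d: "card d = 2" "d \<subseteq> ?W" for d
  proof -
    have "mono_poly (edge_monomial d) \<in> polarization (verts G) J
        \<longleftrightarrow> Poly_Mapping.keys (edge_monomial d) \<subseteq> ?W \<and> (\<exists>g \<in> edge_monomial ` P. mono_le g (edge_monomial d))"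
      unfolding polarization by (rule mono_poly_in_genideal_iff(1)[OF keys])
    also have "\<dots> \<longleftrightarrow> (\<exists>d' \<in> P. mono_le (edge_monomial d') (edge_monomial d))"
      using d by (simp add: keys_edge_monomial)
    also have "\<dots> \<longleftrightarrow> (\<exists>d' \<in> P. d' = d)"
      using mono_le_edge_monomial_iff[OF card_P d(1)] by (intro bex_cong refl) blast
    finally show ?thesis by simp
  qed
  have "edges G' = P"
  proof (intro equalityI subsetI)
    fix d assume "d \<in> edges G'"
    then show "d \<in> P" using member[of d] by (simp add: G' graph_of_ideal_def)
  next
    fix d assume "d \<in> P"
    then show "d \<in> edges G'" using member[of d] card_P[of d] P_W[of d] by (simp add: G' graph_of_ideal_def)
  qed
  then show E: "edges G' = {polarized_edge u v | u v. colon_pair G x y u v}"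
    by (simp add: P_def)
  show "verts G' = verts G \<times> {1} \<union> \<Union> (edges G')"
    unfolding E P_def[symmetric] W[symmetric] by (simp add: G' graph_of_ideal_def)
qed

section \<open>Comparison of the cover numbers\<close>

theorem theorem3p2:
  fixes G :: "'a ugraph" and e :: "'a set"
    and I J :: "('a, 'k::field) mpoly set"
    and G' :: "('a \<times> nat) ugraph"
  assumes "finite_simple_graph G"
    and "e \<in> edges G"
    and "I = edge_ideal G"
    and "J = colon_ideal (mpoly_ring (verts G))
               (ideal_prod (mpoly_ring (verts G)) I I) (mono_poly (edge_monomial e))"
    and "G' = graph_of_ideal (polarization_vars (verts G) J) (polarization (verts G) J)"
  shows "co_chord G' \<le> co_chord G"
proof -
  have G: "simple_graph G" using assms(1) by (simp add: finite_simple_graph_def)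
  obtain x y where e: "e = {x, y}" using simple_graph_edgeE[OF G assms(2)] by metis
  have xy: "{x, y} \<in> edges G" using assms(2) e by simp
  have edges_G': "edges G' = {polarized_edge u v | u v. colon_pair G x y u v}"
    and verts_G': "verts G' = verts G \<times> {1} \<union> \<Union> (edges G')"
    using edges_polarized_colon_graph[OF G xy assms(3) assms(4)[unfolded e] assms(5)] by blast+
  have simple_G': "simple_graph G'"
  proof -
    have "card d = 2" if "d \<in> edges G'" for d
      using that by (auto simp: edges_G' card_polarized_edge)
    moreover have "d \<subseteq> verts G'" if "d \<in> edges G'" for d
      using that by (auto simp: verts_G')
    ultimately show ?thesis by (simp add: simple_graph_def)
  qed
  obtain H where H: "co_chordal_cover G (co_chord G) H"
    using co_chord_attained[OF assms(1)] .
  define n where "n = co_chord G"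
  have sub: "subgraph_of (H i) G" and co: "co_chordal (H i)" if "i < n" for i
    using H that by (auto simp: co_chordal_cover_def n_def)
  have edges_G: "edges G = (\<Union>i < n. edges (H i))" using H by (simp add: co_chordal_cover_def n_def)
  then obtain l where l: "l < n" "{x, y} \<in> edges (H l)" using xy by blast

  \<comment> \<open>Only the member \<open>H l\<close> of the cover, which contains \<open>e\<close>, is enlarged.  It receives all new edges
    at once: the join of the full neighbourhoods of \<open>x\<close> and \<open>y\<close> in \<open>G\<close> and the pendant edges at the
    new vertices.\<close>
  define f :: "'a \<Rightarrow> 'a \<times> nat" where "f v = (v, 1)" for v
  have f: "inj f" by (simp add: f_def inj_def)
  define A where "A = f ` {u. {x, u} \<in> edges G}"
  define B where "B = f ` {u. {y, u} \<in> edges G}"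
  define W where "W = {{(u, 1), (u, 2 :: nat)} | u. {x, u} \<in> edges G \<and> {y, u} \<in> edges G}"
  define join where "join = {{a, b} | a b. a \<in> A \<and> b \<in> B \<and> a \<noteq> b}"
  have old_edge: "f ` d \<in> edges G'" if d: "d \<in> edges G" for d
  proof -
    obtain u v where "d = {u, v}" "u \<noteq> v" using simple_graph_edgeE[OF G d] by metis
    then have "f ` d = polarized_edge u v" "colon_pair G x y u v"
      using d by (auto simp: polarized_edge_def f_def colon_pair_def)
    then show ?thesis unfolding edges_G' by blast
  qed
  have new_edges: "join \<union> W \<subseteq> edges G'"
  proof -
    have "join \<subseteq> {polarized_edge u v | u v. colon_pair G x y u v}"
    proof
      fix d assume "d \<in> join"
      then obtain u v where "d = {f u, f v}" "f u \<noteq> f v" "{x, u} \<in> edges G" "{y, v} \<in> edges G"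
        unfolding join_def A_def B_def by blast
      then have "d = polarized_edge u v" "colon_pair G x y u v"
        by (auto simp: polarized_edge_def f_def colon_pair_def)
      then show "d \<in> {polarized_edge u v | u v. colon_pair G x y u v}" by blast
    qed
    moreover have "W \<subseteq> {polarized_edge u v | u v. colon_pair G x y u v}"
    proof
      fix d assume "d \<in> W"
      then obtain u where "d = {(u, 1), (u, 2)}" "{x, u} \<in> edges G" "{y, u} \<in> edges G"
        unfolding W_def by blast
      then have "d = polarized_edge u u" "colon_pair G x y u u"
        by (auto simp: polarized_edge_def colon_pair_def)
      then show "d \<in> {polarized_edge u v | u v. colon_pair G x y u v}" by blast
    qed
    ultimately show ?thesis by (simp add: edges_G')
  qed
  have edges_split: "edges G' \<subseteq> (`) f ` edges G \<union> (join \<union> W)"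
  proof
    fix d assume "d \<in> edges G'"
    then obtain u v where d: "d = polarized_edge u v" and uv: "colon_pair G x y u v"
      unfolding edges_G' by blast
    show "d \<in> (`) f ` edges G \<union> (join \<union> W)"
    proof (cases "{u, v} \<in> edges G")
      case True
      moreover from this have "u \<noteq> v" using G by (auto simp: simple_graph_def)
      ultimately have "d = f ` {u, v}" by (simp add: d polarized_edge_def f_def)
      then show ?thesis using True by blast
    next
      case False
      then have xu: "{x, u} \<in> edges G" and yv: "{y, v} \<in> edges G"
        using uv by (auto simp: colon_pair_def)
      show ?thesis
      proof (cases "u = v")
        case True
        then have "d = {(u, 1), (u, 2)}" by (simp add: d polarized_edge_def)
        then have "d \<in> W" using xu yv True unfolding W_def by blast
        then show ?thesis by blast
      next
        case False
        then have "d = {f u, f v}" "f u \<noteq> f v" by (simp_all add: d polarized_edge_def f_def)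
        moreover have "f u \<in> A" "f v \<in> B" using xu yv by (simp_all add: A_def B_def)
        ultimately have "d \<in> join" unfolding join_def by blast
        then show ?thesis by blast
      qed
    qed
  qed

  \<comment> \<open>The vertex set of \<open>K l\<close> is large enough for the ends of all new edges; vertices without edges
    do not affect co-chordality.\<close>
  define K where "K i = (if i = l
      then \<lparr>verts = verts G', edges = edges (map_graph f (H i)) \<union> join \<union> W\<rparr>
      else map_graph f (H i))" for i
  have lifted: "edges (map_graph f (H i)) \<subseteq> edges G'" if "i < n" for i
    using sub[OF that] old_edge by (auto simp: subgraph_of_def map_graph_def)
  have "co_chordal_cover G' n K"
    unfolding co_chordal_cover_def
  proof (intro conjI allI impI)
    fix i assume i: "i < n"
    show "subgraph_of (K i) G'"
    proof (cases "i = l")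
      case True
      have "edges (K i) \<subseteq> edges G'" using lifted[OF i] new_edges True by (simp add: K_def)
      moreover have "verts (K i) = verts G'" using True by (simp add: K_def)
      ultimately show ?thesis using simple_G' by (auto simp: subgraph_of_def simple_graph_def)
    next
      case False
      have "verts (map_graph f (H i)) \<subseteq> verts G'"
        using sub[OF i] unfolding verts_G' by (auto simp: subgraph_of_def map_graph_def f_def)
      then show ?thesis
        using False lifted[OF i] sub[OF i] simple_graph_map_graph[OF f]
        by (simp add: subgraph_of_def K_def)
    qed
    show "co_chordal (K i)"
    proof (cases "i = l")
      case True
      let ?H = "map_graph f (H l)"
      have nbr: "z \<in> f ` {u. {p, u} \<in> edges G}" if "{f p, z} \<in> edges ?H" for p z
      proof -
        have "z \<in> range f" using that by (auto simp: map_graph_def)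
        then obtain u where u: "z = f u" by blast
        then have "{p, u} \<in> edges (H l)" using that by (simp add: doubleton_in_edges_map_graph[OF f])
        then show ?thesis using sub[OF l(1)] u by (auto simp: subgraph_of_def)
      qed
      have "co_chordal (K l)"
      proof (rule co_chordal_join[where H = ?H and x = "f x" and y = "f y" and A = A and B = B and W = W])
        show "simple_graph ?H" "co_chordal ?H"
          using sub[OF l(1)] co[OF l(1)] f
          by (auto simp: subgraph_of_def simple_graph_map_graph co_chordal_map_graph)
        show "{f x, f y} \<in> edges ?H" using l(2) by (simp add: doubleton_in_edges_map_graph[OF f])
        show "f y \<in> A" "f x \<in> B" using xy by (auto simp: A_def B_def insert_commute)
        show "\<And>u. {f x, u} \<in> edges ?H \<Longrightarrow> u \<in> A" "\<And>u. {f y, u} \<in> edges ?H \<Longrightarrow> u \<in> B"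
          using nbr by (auto simp: A_def B_def)
        show "edges (K l) = edges ?H \<union> {{a, b} | a b. a \<in> A \<and> b \<in> B \<and> a \<noteq> b} \<union> W"
          by (simp add: K_def join_def)
      next
        fix d assume "d \<in> W"
        then obtain u where u: "d = {f u, (u, 2)}" "{x, u} \<in> edges G" "{y, u} \<in> edges G"
          unfolding W_def f_def by blast
        moreover have "(u, 2) \<notin> A \<union> B \<union> verts ?H"
          by (auto simp: A_def B_def map_graph_def f_def)
        ultimately show "\<exists>a w. d = {a, w} \<and> a \<in> A \<inter> B \<and> w \<notin> A \<union> B \<union> verts ?H"
          by (intro exI[of _ "f u"] exI[of _ "(u, 2)"]) (auto simp: A_def B_def)
      qed
      then show ?thesis using True by simp
    next
      case False
      then show ?thesis using co_chordal_map_graph[OF f co[OF i]] by (simp add: K_def)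
    qed
  next
    show "edges G' = (\<Union>i < n. edges (K i))"
    proof (intro equalityI subsetI)
      fix d assume "d \<in> edges G'"
      then consider "d \<in> (`) f ` edges G" | "d \<in> join \<union> W" using edges_split by blast
      then show "d \<in> (\<Union>i < n. edges (K i))"
      proof cases
        case 1
        then obtain i where "i < n" "d \<in> edges (map_graph f (H i))"
          unfolding edges_G by (auto simp: map_graph_def)
        then show ?thesis by (auto simp: K_def)
      next
        case 2
        then show ?thesis using l(1) by (auto simp: K_def intro!: bexI[of _ l])
      qed
    next
      fix d assume "d \<in> (\<Union>i < n. edges (K i))"
      then show "d \<in> edges G'" using lifted new_edges by (auto simp: K_def split: if_splits)
    qed
  qed
  then show ?thesis using co_chord_le by (simp add: n_def)
qed

end
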